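(* Let $d\ge 1$ be an integer and let $H$ be a nonempty connected simple graph, whose vertex set is endowed with the path metric. Then $H$ is $\mathbb{Z}^d$-Kirszbraun if and only if $H$ is $(2d,2)$-Helly.
   Context: All graphs are nonempty, connected and simple (no loops, no multiple edges); they may be infinite. A graph is identified with its vertex set, viewed as a metric space with the path metric. $\mathbb{Z}^d$ denotes the Cayley graph of the group $\mathbb{Z}^d$ with respect to the standard generators, so its path metric is the $\ell_1$ metric. For metric spaces $X,Y$, we say $Y$ is $X$-Kirszbraun if for every subset $A\subset X$ (with the metric restricted from $X$), every $1$-Lipschitz map $f:A\to Y$ has a $1$-Lipschitz extension $X\to Y$. For integers $n\ge m\ge 1$, a graph $H$ is $(n,m)$-Helly (has the $(n,m)$-Helly's property) if for every collection of $n$ (not necessarily distinct) closed balls $B_1,\dots,B_n$ in $H$ of radius $\ge 1$: whenever every subcollection of $m$ of them has nonempty intersection, then $\bigcap_{i=1}^n B_i\neq\varnothing$. *)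

theory Defs
  imports
    "HOL-Analysis.Analysis"
    "Graph_Theory.Graph_Theory"
begin

text \<open>A (possibly infinite) simple graph is a \<^locale>\<open>pair_bidirected_digraph\<close>: an arc set that is an
  irreflexive symmetric relation on the vertex set, an undirected edge being a pair of opposite arcs.
  Connectedness is \<^const>\<open>Digraph_Component.connected\<close>, which includes nonemptiness.\<close>

definition graph_dist :: "'a pair_pre_digraph \<Rightarrow> 'a \<Rightarrow> 'a \<Rightarrow> nat" where
  "graph_dist G u v = (LEAST n. \<exists>p. pre_digraph.awalk (with_proj G) u p v \<and> length p = n)"

text \<open>Only meaningful for connected simple graphs: otherwise the distance need not be a metric and
  \<^const>\<open>metric\<close> is unspecified.\<close>

definition path_metric :: "'a pair_pre_digraph \<Rightarrow> 'a metric" where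
  "path_metric G = metric (pverts G, \<lambda>u v. real (graph_dist G u v))"

lemma connected_obtain_walk:
  assumes "pair_bidirected_digraph G" "Digraph_Component.connected (with_proj G)"
    and "u \<in> pverts G" "v \<in> pverts G"
  obtains p where "pre_digraph.awalk (with_proj G) u p v" "length p = graph_dist G u v"
proof -
  interpret pair_bidirected_digraph G by fact
  have "u \<rightarrow>\<^sup>*\<^bsub>with_proj (mk_symmetric (with_proj G))\<^esub> v"
    using assms(2-4) unfolding Digraph_Component.connected_def strongly_connected_def
    by simp
  then have "u \<rightarrow>\<^sup>*\<^bsub>with_proj G\<^esub> v"
    using reachable_mk_symmetric_eq[of u v] pair_sym_arcs by simp
  then obtain p where "awalk u p v" using reachable_awalk by auto
  then have "\<exists>n p. awalk u p v \<and> length p = n" by blast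
  from LeastI_ex[OF this] show ?thesis
    using that unfolding graph_dist_def by blast
qed

lemma graph_dist_le:
  "pre_digraph.awalk (with_proj G) u p v \<Longrightarrow> graph_dist G u v \<le> length p"
  unfolding graph_dist_def by (rule Least_le) blast

lemma awalk_rev_exists:
  assumes "pair_bidirected_digraph G" "pre_digraph.awalk (with_proj G) u p v"
  shows "\<exists>q. pre_digraph.awalk (with_proj G) v q u \<and> length q = length p"
proof -
  interpret pair_bidirected_digraph G by fact
  show ?thesis using assms(2)
  proof (induction p arbitrary: u)
    case Nil
    then show ?case by (auto simp: awalk_Nil_iff)
  next
    case (Cons e p)
    from Cons.prems have e: "e \<in> parcs G" "fst e = u" and p: "awalk (snd e) p v"
      by (auto simp: awalk_Cons_iff)
    from Cons.IH[OF p] obtain q where q: "awalk v q (snd e)" "length q = length p" by blast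
    have "(snd e, fst e) \<in> parcs G"
      using e(1) pair_sym_arcs unfolding symmetric_def by (cases e) (auto dest: symD)
    then have "awalk (snd e) [(snd e, u)] u" using e(2) by (auto simp: awalk_Cons_iff awalk_Nil_iff dest: in_arcsD2)
    with q show ?case by (intro exI[of _ "q @ [(snd e, u)]"]) auto
  qed
qed

lemma Metric_space_graph_dist:
  assumes G: "pair_bidirected_digraph G" "Digraph_Component.connected (with_proj G)"
  shows "Metric_space (pverts G) (\<lambda>u v. real (graph_dist G u v))"
proof -
  interpret pair_bidirected_digraph G by (rule G)
  have le: "graph_dist G v u \<le> graph_dist G u v" if "u \<in> pverts G" "v \<in> pverts G" for u v
    by (metis G awalk_rev_exists connected_obtain_walk graph_dist_le that)
  have walk_ends: "u \<in> pverts G \<and> v \<in> pverts G" if "awalk u p v" for u p v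
    using that by (auto dest: awalk_hd_in_verts awalk_last_in_verts)
  have comm: "graph_dist G u v = graph_dist G v u" for u v
  proof (cases "u \<in> pverts G \<and> v \<in> pverts G")
    case True
    then show ?thesis using le by (simp add: le_antisym)
  next
    case False
    then have "\<not> (\<exists>p. awalk u p v)" "\<not> (\<exists>p. awalk v p u)" using walk_ends by blast+
    then show ?thesis unfolding graph_dist_def by simp
  qed
  have zero: "graph_dist G u v = 0 \<longleftrightarrow> u = v" if "u \<in> pverts G" "v \<in> pverts G" for u v
  proof
    assume "graph_dist G u v = 0"
    then show "u = v"
      using connected_obtain_walk[OF G that] by (metis awalk_Nil_iff length_0_conv)
  next
    assume "u = v"
    then show "graph_dist G u v = 0"
      using graph_dist_le[of G u "[]" v] that by (auto simp: awalk_Nil_iff)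
  qed
  have tri: "graph_dist G u w \<le> graph_dist G u v + graph_dist G v w"
    if uvw: "u \<in> pverts G" "v \<in> pverts G" "w \<in> pverts G" for u v w
  proof -
    obtain p where "awalk u p v" "length p = graph_dist G u v"
      using connected_obtain_walk[OF G uvw(1,2)] .
    moreover obtain q where "awalk v q w" "length q = graph_dist G v w"
      using connected_obtain_walk[OF G uvw(2,3)] .
    ultimately show ?thesis using graph_dist_le[of G u "p @ q" w] by auto
  qed
  show ?thesis
    by unfold_locales (use comm zero tri in \<open>simp_all flip: of_nat_add\<close>)
qed

lemma path_metric_simps:
  assumes "pair_bidirected_digraph G" "Digraph_Component.connected (with_proj G)"
  shows "mspace (path_metric G) = pverts G"
    and "mdist (path_metric G) u v = real (graph_dist G u v)"
  using Metric_space_graph_dist[OF assms]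
  by (simp_all add: path_metric_def Metric_space.mspace_metric Metric_space.mdist_metric)

text \<open>The group \<open>\<int>\<^sup>d\<close> is the set of integer sequences vanishing from index \<open>d\<close> on;
  \<open>x(i := x i + 1)\<close> is \<open>x + e\<^sub>i\<close> for the standard generator \<open>e\<^sub>i\<close>.\<close>

definition Zd_graph :: "nat \<Rightarrow> (nat \<Rightarrow> int) pair_pre_digraph" where
  "Zd_graph d = (let V = {x. \<forall>i\<ge>d. x i = 0} in
     \<lparr>pverts = V,
      parcs = {(x, y). x \<in> V \<and> y \<in> V \<and> (\<exists>i<d. y = x(i := x i + 1) \<or> x = y(i := y i + 1))}\<rparr>)"

lemma Zd_graph_simple: "pair_bidirected_digraph (Zd_graph d)"
proof unfold_locales
  show "symmetric (with_proj (Zd_graph d))"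
    unfolding symmetric_def by (auto simp: Zd_graph_def intro!: symI)
next
  fix e
  assume "e \<in> parcs (Zd_graph d)"
  then obtain i where "snd e = (fst e)(i := fst e i + 1) \<or> fst e = (snd e)(i := snd e i + 1)"
    unfolding Zd_graph_def Let_def by fastforce
  then have "fst e i \<noteq> snd e i" by (metis add_cancel_right_right fun_upd_same zero_neq_one)
  then show "fst e \<noteq> snd e" by metis
qed (auto simp: Zd_graph_def)

lemma Zd_graph_connected: "Digraph_Component.connected (with_proj (Zd_graph d))"
proof -
  let ?G = "Zd_graph d"
  interpret pair_bidirected_digraph "?G" by (rule Zd_graph_simple)
  have V: "x \<in> pverts ?G \<longleftrightarrow> (\<forall>i\<ge>d. x i = 0)" for x by (simp add: Zd_graph_def)
  have step: "(x, x(i := x i + 1)) \<in> parcs ?G \<and> (x(i := x i + 1), x) \<in> parcs ?G"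
    if "x \<in> pverts ?G" "i < d" for x i
    using that by (auto simp: Zd_graph_def)
  have up: "x \<rightarrow>\<^sup>*\<^bsub>?G\<^esub> x(i := x i + int n) \<and> x(i := x i + int n) \<rightarrow>\<^sup>*\<^bsub>?G\<^esub> x"
    if x: "x \<in> pverts ?G" and i: "i < d" for x i n
  proof (induction n)
    case 0
    then show ?case using x by simp
  next
    case (Suc n)
    let ?y = "x(i := x i + int n)"
    have "?y \<in> pverts ?G" using x i by (auto simp: V)
    from step[OF this i]
    have "(?y, x(i := x i + int (Suc n))) \<in> parcs ?G" "(x(i := x i + int (Suc n)), ?y) \<in> parcs ?G"
      by (simp_all add: algebra_simps)
    then have "?y \<rightarrow>\<^sup>*\<^bsub>?G\<^esub> x(i := x i + int (Suc n))" "x(i := x i + int (Suc n)) \<rightarrow>\<^sup>*\<^bsub>?G\<^esub> ?y"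
      by (auto intro: reachable_adjI)
    then show ?case using Suc.IH reachable_trans by blast
  qed
  have move: "x \<rightarrow>\<^sup>*\<^bsub>?G\<^esub> x(i := k)" if x: "x \<in> pverts ?G" and i: "i < d" for x i k
  proof (cases "x i \<le> k")
    case True
    then show ?thesis using up[OF x i, of "nat (k - x i)"] by simp
  next
    case False
    have "x(i := k) \<in> pverts ?G" using x i by (auto simp: V)
    from up[OF this i, of "nat (x i - k)"] show ?thesis using False by simp
  qed
  have "x \<rightarrow>\<^sup>*\<^bsub>?G\<^esub> y" if x: "x \<in> pverts ?G" and y: "y \<in> pverts ?G" for x y
  proof -
    have "n \<le> d \<Longrightarrow> x \<rightarrow>\<^sup>*\<^bsub>?G\<^esub> (\<lambda>j. if j < n then y j else x j)" for n
    proof (induction n)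
      case 0
      then show ?case using x by simp
    next
      case (Suc n)
      let ?z = "\<lambda>j. if j < n then y j else x j"
      have "?z \<in> pverts ?G" using x y by (auto simp: V)
      then have "?z \<rightarrow>\<^sup>*\<^bsub>?G\<^esub> ?z(n := y n)" using move Suc.prems by simp
      moreover have "?z(n := y n) = (\<lambda>j. if j < Suc n then y j else x j)"
        by (auto simp: fun_eq_iff less_Suc_eq)
      ultimately show ?case using Suc reachable_trans by (metis Suc_leD)
    qed
    from this[of d] have "x \<rightarrow>\<^sup>*\<^bsub>?G\<^esub> (\<lambda>j. if j < d then y j else x j)" by simp
    also have "(\<lambda>j. if j < d then y j else x j) = y"
      using x y by (auto simp: fun_eq_iff V)
    finally show ?thesis .
  qed
  moreover have "(\<lambda>_. 0) \<in> pverts ?G" by (simp add: V)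
  ultimately show ?thesis
    unfolding Digraph_Component.connected_def strongly_connected_def
    using reachable_mk_symmetric_eq pair_sym_arcs by auto
qed

definition one_Lipschitz :: "'a metric \<Rightarrow> 'b metric \<Rightarrow> ('a \<Rightarrow> 'b) \<Rightarrow> bool" where
  "one_Lipschitz X Y f \<longleftrightarrow> f \<in> mspace X \<rightarrow> mspace Y \<and>
     (\<forall>x\<in>mspace X. \<forall>y\<in>mspace X. mdist Y (f x) (f y) \<le> mdist X x y)"

definition Kirszbraun :: "'a metric \<Rightarrow> 'b metric \<Rightarrow> bool" where
  "Kirszbraun X Y \<longleftrightarrow> (\<forall>A f. A \<subseteq> mspace X \<and> one_Lipschitz (submetric X A) Y f \<longrightarrow>
     (\<exists>g. one_Lipschitz X Y g \<and> (\<forall>a\<in>A. g a = f a)))"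

text \<open>The balls are indexed by \<open>{1..n}\<close>, since they need not be distinct.\<close>

definition Helly :: "nat \<Rightarrow> nat \<Rightarrow> 'a pair_pre_digraph \<Rightarrow> bool" where
  "Helly n m H \<longleftrightarrow> (\<forall>(c :: nat \<Rightarrow> 'a) (r :: nat \<Rightarrow> real).
     (\<forall>i\<in>{1..n}. c i \<in> pverts H \<and> 1 \<le> r i) \<and>
     (\<forall>I\<subseteq>{1..n}. card I = m \<longrightarrow> (\<Inter>i\<in>I. mcball_of (path_metric H) (c i) (r i)) \<noteq> {}) \<longrightarrow>
     (\<Inter>i\<in>{1..n}. mcball_of (path_metric H) (c i) (r i)) \<noteq> {})"

end

theory Submission
  imports Defs
begin

text \<open>If \<open>H\<close> is Kirszbraun, put the \<open>2d\<close> centres on the \<open>2d\<close> half-axes of \<open>\<int>\<^sup>d\<close> at the distance from the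
  origin given by the radii, and extend to the origin.

  Conversely, by Zorn's lemma it is enough to extend a 1-Lipschitz map \<open>f\<close> on \<open>A\<close> to one more point \<open>b\<close>, and
  a point of \<open>A\<close> can be discarded when another one lies on a geodesic from it to \<open>b\<close>. So by Dickson's
  lemma \<open>A\<close> may be assumed finite, and one inducts on its cardinality. If \<open>card A \<le> 2d\<close>, then the Helly
  property applies. Otherwise some \<open>z \<in> A\<close> is not the only extremal point of \<open>A\<close> in any of the \<open>2d\<close>
  directions. Walking backwards from \<open>z\<close> to \<open>b\<close>, one extends \<open>f\<close> to each point on the way: \<open>z\<close> and a second
  point of \<open>A\<close> lie beyond the previously extended neighbour, which replaces both of them.\<close>

section \<open>Path metrics\<close>

text \<open>Cut a shortest walk after its first \<open>m\<close> arcs. This yields a common point of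
  two balls whose integer radii add up to at least the distance of their centres.\<close>

lemma graph_dist_split:
  assumes G: "pair_bidirected_digraph G" "Digraph_Component.connected (with_proj G)"
    and uv: "u \<in> pverts G" "v \<in> pverts G" and le: "graph_dist G u v \<le> m + n"
  obtains w where "w \<in> pverts G" "graph_dist G u w \<le> m" "graph_dist G w v \<le> n"
proof -
  interpret pair_bidirected_digraph G by (rule G)
  obtain p where p: "awalk u p v" "length p = graph_dist G u v"
    using connected_obtain_walk[OF G uv] .
  then have "awalk u (take m p @ drop m p) v" by simp
  then obtain w where w: "awalk u (take m p) w" "awalk w (drop m p) v"
    unfolding awalk_append_iff by blast
  show ?thesis
  proof
    show "w \<in> pverts G" using w(2) by auto
    show "graph_dist G u w \<le> m" using graph_dist_le[OF w(1)] by simp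
    show "graph_dist G w v \<le> n" using graph_dist_le[OF w(2)] p(2) le by simp
  qed
qed

section \<open>The path metric of \<open>Zd_graph d\<close> as an explicit sum\<close>

definition l1_dist :: "nat \<Rightarrow> (nat \<Rightarrow> int) \<Rightarrow> (nat \<Rightarrow> int) \<Rightarrow> int" where
  "l1_dist d x y = (\<Sum>i<d. \<bar>x i - y i\<bar>)"

lemma l1_dist_nonneg: "0 \<le> l1_dist d x y"
  by (simp add: l1_dist_def sum_nonneg)

lemma l1_dist_commute: "l1_dist d x y = l1_dist d y x"
  by (simp add: l1_dist_def abs_minus_commute)

lemma l1_dist_upd:
  assumes "i < d"
  shows "l1_dist d (x(i := k)) y = l1_dist d x y - \<bar>x i - y i\<bar> + \<bar>k - y i\<bar>"
proof -
  have "l1_dist d z y = \<bar>z i - y i\<bar> + (\<Sum>j\<in>{..<d} - {i}. \<bar>z j - y j\<bar>)" for z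
    unfolding l1_dist_def using assms by (subst sum.remove[of _ i]) auto
  from this[of x] this[of "x(i := k)"] show ?thesis by simp
qed

lemma Zd_verts: "x \<in> pverts (Zd_graph d) \<longleftrightarrow> (\<forall>i\<ge>d. x i = 0)"
  by (simp add: Zd_graph_def)

lemma l1_dist_eq_0_iff:
  assumes "x \<in> pverts (Zd_graph d)" "y \<in> pverts (Zd_graph d)"
  shows "l1_dist d x y = 0 \<longleftrightarrow> x = y"
proof
  assume "l1_dist d x y = 0"
  then have "\<forall>i<d. x i = y i" by (auto simp: l1_dist_def sum_nonneg_eq_0_iff)
  then show "x = y" using assms by (metis Zd_verts ext not_less)
qed (simp add: l1_dist_def)

text \<open>Move by one unit towards \<open>y\<close> in a coordinate where the points differ. The
  pair \<open>(i, s)\<close> later selects the direction in which \<open>z\<close> is compared with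
  the other points of \<open>A\<close>.\<close>

lemma Zd_step:
  assumes "x \<in> pverts (Zd_graph d)" "y \<in> pverts (Zd_graph d)" "x \<noteq> y"
  obtains i s where "i < d" "s = 1 \<or> s = - 1" "0 < s * (y i - x i)"
    "l1_dist d x y = l1_dist d (x(i := x i + s)) y + 1"
proof -
  obtain i where i: "i < d" "x i \<noteq> y i" using assms by (metis Zd_verts ext not_less)
  define s where "s = sgn (y i - x i)"
  have "s = 1 \<or> s = - 1" "0 < s * (y i - x i)" "\<bar>x i - y i\<bar> = \<bar>x i + s - y i\<bar> + 1"
    using i(2) by (auto simp: s_def sgn_if)
  then show ?thesis using that[of i s] i(1) by (simp add: l1_dist_upd)
qed

text \<open>An arc changes one coordinate by one, so no walk is shorter than \<open>l1_dist\<close>;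
  iterating \<open>Zd_step\<close> gives a walk of exactly that length.\<close>

lemma Zd_graph_dist:
  assumes "x \<in> pverts (Zd_graph d)" "y \<in> pverts (Zd_graph d)"
  shows "int (graph_dist (Zd_graph d) x y) = l1_dist d x y"
proof (rule antisym)
  interpret pair_bidirected_digraph "Zd_graph d" by (rule Zd_graph_simple)
  obtain p where "awalk x p y" "length p = graph_dist (Zd_graph d) x y"
    using connected_obtain_walk[OF Zd_graph_simple Zd_graph_connected assms] .
  moreover have "awalk x p y \<Longrightarrow> l1_dist d x y \<le> int (length p)" for x p
  proof (induction p arbitrary: x)
    case Nil
    then show ?case by (simp add: awalk_Nil_iff l1_dist_def)
  next
    case (Cons e p)
    then have e: "e \<in> parcs (Zd_graph d)" "fst e = x" and p: "awalk (snd e) p y"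
      by (auto simp: awalk_Cons_iff)
    from e obtain i where i: "i < d" "snd e = x(i := x i + 1) \<or> x = (snd e)(i := snd e i + 1)"
      by (auto simp: Zd_graph_def)
    then have "l1_dist d x y \<le> l1_dist d (snd e) y + 1"
    proof (elim disjE)
      assume "snd e = x(i := x i + 1)"
      then show ?thesis using l1_dist_upd[OF i(1), of x "x i + 1" y] by simp
    next
      assume "x = (snd e)(i := snd e i + 1)"
      then show ?thesis using l1_dist_upd[OF i(1), of "snd e" "snd e i + 1" y] by simp
    qed
    then show ?case using Cons.IH[OF p] by simp
  qed
  ultimately show "l1_dist d x y \<le> int (graph_dist (Zd_graph d) x y)" by metis
next
  interpret pair_bidirected_digraph "Zd_graph d" by (rule Zd_graph_simple)
  have "\<exists>p. awalk x p y \<and> length p = n" if "l1_dist d x y = int n" for n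
    using assms(1) that
  proof (induction n arbitrary: x)
    case 0
    then show ?case using assms(2) by (simp add: l1_dist_eq_0_iff awalk_Nil_iff)
  next
    case (Suc n)
    then have "x \<noteq> y" by (auto simp: l1_dist_def)
    then obtain i s where i: "i < d" "s = 1 \<or> s = - 1"
      "l1_dist d x y = l1_dist d (x(i := x i + s)) y + 1"
      using Zd_step Suc.prems(1) assms(2) by metis
    let ?x = "x(i := x i + s)"
    have x': "?x \<in> pverts (Zd_graph d)" using Suc.prems(1) i(1) by (auto simp: Zd_verts)
    moreover have "l1_dist d ?x y = int n" using i(3) Suc.prems(2) by simp
    ultimately obtain p where p: "awalk ?x p y" "length p = n" using Suc.IH by blast
    have "(x, ?x) \<in> parcs (Zd_graph d)"
      using Suc.prems(1) i x' by (auto simp: Zd_graph_def)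
    then have "awalk x ((x, ?x) # p) y" using p(1) Suc.prems(1) by (simp add: awalk_Cons_iff)
    then show ?case using p(2) by (metis length_Cons)
  qed
  from this[of "nat (l1_dist d x y)"] obtain p where "awalk x p y" "length p = nat (l1_dist d x y)"
    by (auto simp: l1_dist_nonneg)
  then show "int (graph_dist (Zd_graph d) x y) \<le> l1_dist d x y"
    using graph_dist_le[of "Zd_graph d" x p y] l1_dist_nonneg[of d x y] by simp
qed

lemma Zd_mspace: "mspace (path_metric (Zd_graph d)) = pverts (Zd_graph d)"
  by (rule path_metric_simps[OF Zd_graph_simple Zd_graph_connected])

lemma Zd_mdist:
  assumes "x \<in> pverts (Zd_graph d)" "y \<in> pverts (Zd_graph d)"
  shows "mdist (path_metric (Zd_graph d)) x y = real_of_int (l1_dist d x y)"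
  using Zd_graph_dist[OF assms] path_metric_simps(2)[OF Zd_graph_simple Zd_graph_connected]
  by (metis of_int_of_nat_eq)

section \<open>One-point extensions\<close>

lemma one_Lipschitz_submetric:
  assumes "A \<subseteq> mspace X"
  shows "one_Lipschitz (submetric X A) Y f \<longleftrightarrow>
    f \<in> A \<rightarrow> mspace Y \<and> (\<forall>x\<in>A. \<forall>y\<in>A. mdist Y (f x) (f y) \<le> mdist X x y)"
  using assms by (simp add: one_Lipschitz_def inf.absorb1)

lemma mdist_self_le: "y \<in> mspace Y \<Longrightarrow> mdist Y y y \<le> mdist X x x'"
  by (metis mdist_nonneg mdist_zero)

text \<open>The case of \<open>b\<close> in \<open>A\<close> is included: for a 1-Lipschitz
  \<open>f\<close> the zero distance then forces \<open>y = f b\<close>.\<close>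

definition point_extends ::
  "'a metric \<Rightarrow> 'b metric \<Rightarrow> 'a set \<Rightarrow> ('a \<Rightarrow> 'b) \<Rightarrow> 'a \<Rightarrow> bool" where
  "point_extends X Y A f b \<longleftrightarrow> (\<exists>y\<in>mspace Y. \<forall>a\<in>A. mdist Y (f a) y \<le> mdist X a b)"

text \<open>The triangle inequality through \<open>f a'\<close> transfers the bound at
  \<open>a'\<close> to every \<open>a\<close> for which \<open>a'\<close> lies on a geodesic to
  \<open>b\<close>.\<close>

lemma point_extends_geodesic:
  assumes "f \<in> A \<rightarrow> mspace Y" "B \<subseteq> A" "point_extends X Y B f b"
    and "\<And>a. a \<in> A \<Longrightarrow> \<exists>a'\<in>B. mdist X a b = mdist X a a' + mdist X a' b
      \<and> mdist Y (f a) (f a') \<le> mdist X a a'"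
  shows "point_extends X Y A f b"
proof -
  obtain y where y: "y \<in> mspace Y" "\<And>a. a \<in> B \<Longrightarrow> mdist Y (f a) y \<le> mdist X a b"
    using assms(3) unfolding point_extends_def by blast
  have "mdist Y (f a) y \<le> mdist X a b" if a: "a \<in> A" for a
  proof -
    obtain a' where a': "a' \<in> B" "mdist X a b = mdist X a a' + mdist X a' b"
      "mdist Y (f a) (f a') \<le> mdist X a a'"
      using assms(4)[OF a] by blast
    have "mdist Y (f a) y \<le> mdist Y (f a) (f a') + mdist Y (f a') y"
      using a a'(1) assms(1,2) y(1) by (intro mdist_triangle) auto
    then show ?thesis using a' y(2)[of a'] by simp
  qed
  then show ?thesis using y(1) unfolding point_extends_def by blast
qed

text \<open>A maximal 1-Lipschitz partial extension has full domain, since \<open>ext\<close> would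
  add a missing point.\<close>

lemma Kirszbraun_if_point_extends:
  assumes ext: "\<And>A f b. A \<subseteq> mspace X \<Longrightarrow> b \<in> mspace X \<Longrightarrow> one_Lipschitz (submetric X A) Y f
    \<Longrightarrow> point_extends X Y A f b"
  shows "Kirszbraun X Y"
  unfolding Kirszbraun_def
proof (intro allI impI, elim conjE)
  fix A f
  assume A: "A \<subseteq> mspace X" and f: "one_Lipschitz (submetric X A) Y f"
  \<comment> \<open>Partial maps are sets of pairs. The inequality itself makes them single-valued
    (\<open>unique\<close> below), and a condition on two elements at a time passes to unions of
    chains.\<close>
  define good where "good R \<longleftrightarrow> (\<forall>p\<in>R. \<forall>q\<in>R. fst p \<in> mspace X \<and> snd p \<in> mspace Y \<and>
    mdist Y (snd p) (snd q) \<le> mdist X (fst p) (fst q))" for R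
  define R0 where "R0 = (\<lambda>a. (a, f a)) ` A"
  \<comment> \<open>Only the part \<open>R\<close> added to \<open>R0\<close> is ordered, so that
    the empty chain, with union \<open>{}\<close>, reduces to \<open>good R0\<close>.\<close>
  have "\<exists>M\<in>{R. good (R0 \<union> R)}. \<forall>R\<in>{R. good (R0 \<union> R)}. M \<subseteq> R \<longrightarrow> R = M"
  proof (rule subset_Zorn')
    fix C
    assume C: "subset.chain {R. good (R0 \<union> R)} C"
    have R0: "good R0"
      using f A unfolding one_Lipschitz_submetric[OF A] good_def R0_def by auto
    have CR: "good (R0 \<union> R)" if "R \<in> C" for R
      using C that unfolding subset_chain_def by blast
    have "\<exists>R. good R \<and> p \<in> R \<and> q \<in> R" if p: "p \<in> R0 \<union> \<Union>C" and q: "q \<in> R0 \<union> \<Union>C" for p q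
    proof -
      consider "p \<in> R0" "q \<in> R0" | R where "R \<in> C" "p \<in> R0 \<union> R" "q \<in> R0 \<union> R"
        using p q C unfolding subset_chain_def by blast
      then show ?thesis using R0 CR by cases blast+
    qed
    then have "good (R0 \<union> \<Union>C)" unfolding good_def by meson
    then show "\<Union>C \<in> {R. good (R0 \<union> R)}" by simp
  qed
  then obtain M where M: "good (R0 \<union> M)" "\<And>R. good (R0 \<union> R) \<Longrightarrow> M \<subseteq> R \<Longrightarrow> R = M" by blast
  have goodD: "x \<in> mspace X" "y \<in> mspace Y" "mdist Y y y' \<le> mdist X x x'"
    if "(x, y) \<in> R0 \<union> M" "(x', y') \<in> R0 \<union> M" for x y x' y'
    using M(1) that unfolding good_def by force+
  define g where "g x = (SOME y. (x, y) \<in> R0 \<union> M)" for x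
  have gM: "(x, g x) \<in> R0 \<union> M" if "x \<in> Domain (R0 \<union> M)" for x
    using that unfolding g_def Domain_iff by (rule someI_ex)
  have unique: "y = y'" if "(x, y) \<in> R0 \<union> M" "(x, y') \<in> R0 \<union> M" for x y y'
  proof -
    have "mdist Y y y' \<le> mdist X x x" "x \<in> mspace X" "y \<in> mspace Y" "y' \<in> mspace Y"
      using goodD that by blast+
    then show ?thesis by (metis mdist_zero mdist_nonneg antisym)
  qed
  have D: "Domain (R0 \<union> M) \<subseteq> mspace X" using goodD(1) by blast
  have g: "one_Lipschitz (submetric X (Domain (R0 \<union> M))) Y g"
    unfolding one_Lipschitz_submetric[OF D] using goodD(2,3)[OF gM gM] by blast
  have "b \<in> Domain (R0 \<union> M)" if b: "b \<in> mspace X" for b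
  proof -
    obtain y where y: "y \<in> mspace Y" "\<And>a. a \<in> Domain (R0 \<union> M) \<Longrightarrow> mdist Y (g a) y \<le> mdist X a b"
      using ext[OF D b g] unfolding point_extends_def by blast
    have new: "mdist Y z y \<le> mdist X a b" if "(a, z) \<in> R0 \<union> M" for a z
      using y(2)[of a] unique[OF that gM] that by blast
    have "good (insert (b, y) (R0 \<union> M))"
      unfolding good_def
    proof (intro ballI)
      fix p q
      assume "p \<in> insert (b, y) (R0 \<union> M)" "q \<in> insert (b, y) (R0 \<union> M)"
      then consider "p = (b, y)" "q = (b, y)" | "p = (b, y)" "q \<in> R0 \<union> M"
        | "p \<in> R0 \<union> M" "q = (b, y)" | "p \<in> R0 \<union> M" "q \<in> R0 \<union> M" by blast
      then show "fst p \<in> mspace X \<and> snd p \<in> mspace Y \<and>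
          mdist Y (snd p) (snd q) \<le> mdist X (fst p) (fst q)"
      proof cases
        case 1
        then show ?thesis using b y(1) by (simp add: mdist_self_le)
      next
        case 2
        then show ?thesis using b y(1) new[of "fst q" "snd q"] by (simp add: mdist_commute)
      next
        case 3
        then show ?thesis
          using goodD[of "fst p" "snd p" "fst p" "snd p"] new[of "fst p" "snd p"] by simp
      next
        case 4
        then show ?thesis using goodD[of "fst p" "snd p" "fst q" "snd q"] by simp
      qed
    qed
    then have "good (R0 \<union> insert (b, y) M)" by simp
    from M(2)[OF this subset_insertI] show ?thesis by blast
  qed
  then have "Domain (R0 \<union> M) = mspace X" using D by blast
  moreover have "\<forall>a\<in>A. g a = f a" using unique gM unfolding R0_def by blast
  ultimately show "\<exists>g. one_Lipschitz X Y g \<and> (\<forall>a\<in>A. g a = f a)"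
    using g by (metis submetric_mspace)
qed

section \<open>Reduction to finite sets\<close>

text \<open>Induction on the set of coordinates. If \<open>F\<close> dominates \<open>S\<close> in
  the coordinates \<open>I\<close> and \<open>M\<close> bounds coordinate \<open>j\<close> on
  \<open>F\<close>, then \<open>F\<close> also handles every point whose coordinate \<open>j\<close>
  is at least \<open>M\<close>. Each of the finitely many slices with coordinate \<open>j\<close>
  equal to some \<open>m < M\<close> has a finite dominating set by induction.\<close>

lemma Dickson:
  fixes \<phi> :: "'a \<Rightarrow> 'b \<Rightarrow> nat"
  assumes "finite I"
  obtains F where "finite F" "F \<subseteq> S" "\<And>a. a \<in> S \<Longrightarrow> \<exists>a'\<in>F. \<forall>i\<in>I. \<phi> a' i \<le> \<phi> a i"
proof -
  have "\<exists>F. finite F \<and> F \<subseteq> S \<and> (\<forall>a\<in>S. \<exists>a'\<in>F. \<forall>i\<in>I. \<phi> a' i \<le> \<phi> a i)"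
    using assms
  proof (induction I arbitrary: S)
    case empty
    show ?case
    proof (cases "S = {}")
      case False
      then obtain a where "a \<in> S" by blast
      then show ?thesis by (intro exI[of _ "{a}"]) auto
    qed auto
  next
    case (insert j I)
    define dom where "dom J S F \<longleftrightarrow> finite F \<and> F \<subseteq> S \<and> (\<forall>a\<in>S. \<exists>a'\<in>F. \<forall>i\<in>J. \<phi> a' i \<le> \<phi> a i)" for J S F
    obtain F where F: "dom I S F" using insert.IH[of S] unfolding dom_def by blast
    obtain M where M: "\<And>a. a \<in> F \<Longrightarrow> \<phi> a j \<le> M"
      using F finite_imageI[of F "\<lambda>a. \<phi> a j"] unfolding dom_def finite_nat_set_iff_bounded_le by blast
    have "\<exists>G. dom I {a \<in> S. \<phi> a j = m} G" for m
      using insert.IH[of "{a \<in> S. \<phi> a j = m}"] unfolding dom_def by blast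
    then obtain G where G: "\<And>m. dom I {a \<in> S. \<phi> a j = m} (G m)" by metis
    have "dom (insert j I) S (F \<union> (\<Union>m<M. G m))"
      unfolding dom_def
    proof (intro conjI ballI)
      show "finite (F \<union> (\<Union>m<M. G m))" using F G unfolding dom_def by blast
      show "F \<union> (\<Union>m<M. G m) \<subseteq> S" using F G unfolding dom_def by blast
      fix a
      assume a: "a \<in> S"
      show "\<exists>a'\<in>F \<union> (\<Union>m<M. G m). \<forall>i\<in>insert j I. \<phi> a' i \<le> \<phi> a i"
      proof (cases "\<phi> a j < M")
        case True
        obtain a' where "a' \<in> G (\<phi> a j)" "\<phi> a' j = \<phi> a j" "\<forall>i\<in>I. \<phi> a' i \<le> \<phi> a i"
          using G[of "\<phi> a j"] a unfolding dom_def by blast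
        then show ?thesis using True by (intro bexI[of _ a']) auto
      next
        case False
        obtain a' where "a' \<in> F" "\<forall>i\<in>I. \<phi> a' i \<le> \<phi> a i"
          using F a unfolding dom_def by blast
        then show ?thesis using False M[of a'] by (intro bexI[of _ a']) auto
      qed
    qed
    then show ?case unfolding dom_def by (rule exI)
  qed
  then show ?thesis using that by blast
qed

text \<open>Dickson's lemma is applied to the positive and negative parts of the coordinates of
  \<open>a - b\<close>. If none of these \<open>2d\<close> numbers is larger for \<open>a'\<close>
  than for \<open>a\<close>, then each coordinate of \<open>a'\<close> lies between those of
  \<open>a\<close> and \<open>b\<close>, so \<open>a'\<close> is on a geodesic.\<close>

lemma Zd_finite_geodesic_subset:
  obtains F where "finite F" "F \<subseteq> A"
    "\<And>a. a \<in> A \<Longrightarrow> \<exists>a'\<in>F. l1_dist d a b = l1_dist d a a' + l1_dist d a' b"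
proof -
  define \<phi> where "\<phi> a = (\<lambda>(i, pos). nat (if pos then a i - b i else b i - a i))"
    for a :: "nat \<Rightarrow> int"
  obtain F where F: "finite F" "F \<subseteq> A"
    "\<And>a. a \<in> A \<Longrightarrow> \<exists>a'\<in>F. \<forall>i\<in>{..<d} \<times> UNIV. \<phi> a' i \<le> \<phi> a i"
    using Dickson[of "{..<d} \<times> (UNIV :: bool set)" A \<phi>] by auto
  have "l1_dist d a b = l1_dist d a a' + l1_dist d a' b"
    if "\<forall>i\<in>{..<d} \<times> UNIV. \<phi> a' i \<le> \<phi> a i" for a a'
  proof -
    have "\<bar>a i - b i\<bar> = \<bar>a i - a' i\<bar> + \<bar>a' i - b i\<bar>" if "i < d" for i
    proof -
      have "\<phi> a' (i, True) \<le> \<phi> a (i, True)" "\<phi> a' (i, False) \<le> \<phi> a (i, False)"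
        using that \<open>\<forall>i\<in>{..<d} \<times> UNIV. \<phi> a' i \<le> \<phi> a i\<close> by auto
      then show ?thesis unfolding \<phi>_def by simp
    qed
    then show ?thesis unfolding l1_dist_def by (simp flip: sum.distrib)
  qed
  then show ?thesis using that F by meson
qed

section \<open>Helly's property\<close>

text \<open>The radii are real but distances are integers, hence the floors: around adjacent
  vertices, two balls of radius 1/2 are disjoint.\<close>

lemma ball_inter_nonempty_iff:
  assumes H: "pair_bidirected_digraph H" "Digraph_Component.connected (with_proj H)"
    and uv: "u \<in> pverts H" "v \<in> pverts H"
  shows "mcball_of (path_metric H) u r \<inter> mcball_of (path_metric H) v s \<noteq> {} \<longleftrightarrow>
    0 \<le> r \<and> 0 \<le> s \<and> int (graph_dist H u v) \<le> \<lfloor>r\<rfloor> + \<lfloor>s\<rfloor>"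
proof
  assume "mcball_of (path_metric H) u r \<inter> mcball_of (path_metric H) v s \<noteq> {}"
  then obtain w where w: "w \<in> pverts H" "real (graph_dist H u w) \<le> r" "real (graph_dist H v w) \<le> s"
    by (auto simp: in_mcball_of path_metric_simps[OF H])
  have "real (graph_dist H u v) \<le> real (graph_dist H u w) + real (graph_dist H v w)"
    using mdist_triangle[of u "path_metric H" w v] uv w(1)
    by (simp add: path_metric_simps[OF H] mdist_commute[of "path_metric H" w v, unfolded path_metric_simps[OF H]])
  moreover have "int (graph_dist H u w) \<le> \<lfloor>r\<rfloor>" "int (graph_dist H v w) \<le> \<lfloor>s\<rfloor>"
    using w by (simp_all add: le_floor_iff)
  moreover have "0 \<le> r" "0 \<le> s" using w order_trans[OF of_nat_0_le_iff] by blast+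
  ultimately show "0 \<le> r \<and> 0 \<le> s \<and> int (graph_dist H u v) \<le> \<lfloor>r\<rfloor> + \<lfloor>s\<rfloor>" by linarith
next
  assume rs: "0 \<le> r \<and> 0 \<le> s \<and> int (graph_dist H u v) \<le> \<lfloor>r\<rfloor> + \<lfloor>s\<rfloor>"
  then have "graph_dist H u v \<le> nat \<lfloor>r\<rfloor> + nat \<lfloor>s\<rfloor>" by linarith
  from graph_dist_split[OF H uv this]
  obtain w where w: "w \<in> pverts H" "graph_dist H u w \<le> nat \<lfloor>r\<rfloor>" "graph_dist H w v \<le> nat \<lfloor>s\<rfloor>" .
  have "real (graph_dist H u w) \<le> r" "real (graph_dist H w v) \<le> s"
    using w rs by linarith+
  then have "w \<in> mcball_of (path_metric H) u r \<inter> mcball_of (path_metric H) v s"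
    using w(1) uv mdist_commute[of "path_metric H" w v]
    by (simp add: in_mcball_of path_metric_simps[OF H])
  then show "mcball_of (path_metric H) u r \<inter> mcball_of (path_metric H) v s \<noteq> {}" by blast
qed

text \<open>A value at \<open>b\<close> is a common point of the balls around \<open>f a\<close>
  whose radius is the distance from \<open>a\<close> to \<open>b\<close>. Any two of them meet by
  the triangle inequality through \<open>b\<close>.\<close>

lemma point_extends_small:
  assumes H: "pair_bidirected_digraph H" "Digraph_Component.connected (with_proj H)"
    and helly: "Helly n 2 H"
    and A: "finite A" "card A \<le> n" "A \<subseteq> pverts (Zd_graph d)" and b: "b \<in> pverts (Zd_graph d)"
    and f: "one_Lipschitz (submetric (path_metric (Zd_graph d)) A) (path_metric H) f"
  shows "point_extends (path_metric (Zd_graph d)) (path_metric H) A f b"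
proof -
  let ?X = "path_metric (Zd_graph d)" and ?Y = "path_metric H"
  note H_simps = path_metric_simps[OF H]
  have AX: "A \<subseteq> mspace ?X" using A(3) by (simp add: Zd_mspace)
  have fA: "\<And>a. a \<in> A \<Longrightarrow> f a \<in> pverts H"
    and lip: "\<And>a a'. a \<in> A \<Longrightarrow> a' \<in> A \<Longrightarrow> mdist ?Y (f a) (f a') \<le> mdist ?X a a'"
    using f unfolding one_Lipschitz_submetric[OF AX] by (auto simp: H_simps)
  consider "A = {}" | "b \<in> A" | "A \<noteq> {}" "b \<notin> A" by blast
  then show ?thesis
  proof cases
    case 1
    have "pverts H \<noteq> {}" using H(2)
      by (auto simp: Digraph_Component.connected_def strongly_connected_def)
    then show ?thesis using 1 by (auto simp: point_extends_def H_simps)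
  next
    case 2
    then show ?thesis using lip fA by (auto simp: point_extends_def H_simps(1))
  next
    case 3
    \<comment> \<open>\<open>Helly\<close> wants exactly \<open>n\<close> balls, so \<open>A\<close>
      is enumerated by \<open>{1..n}\<close> with repetitions.\<close>
    have "\<exists>h. h ` A \<subseteq> {1..n} \<and> inj_on h A"
      using A(1,2) by (intro card_le_inj) auto
    then obtain g where g: "g ` {1..n} = A" using inj_on_iff_surj[OF 3(1)] by metis
    define r where "r i = mdist ?X (g i) b" for i
    have r: "r i = real_of_int (l1_dist d (g i) b)" "1 \<le> r i" if "i \<in> {1..n}" for i
    proof -
      have gi: "g i \<in> A" using that g by blast
      then show r_eq: "r i = real_of_int (l1_dist d (g i) b)"
        using A(3) b by (auto simp: r_def Zd_mdist)
      \<comment> \<open>Here \<open>b\<close> outside \<open>A\<close> gives the lower bound 1 on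
        the radii.\<close>
      have "l1_dist d (g i) b \<noteq> 0" using gi 3(2) A(3) b by (metis l1_dist_eq_0_iff subsetD)
      then show "1 \<le> r i" using l1_dist_nonneg[of d "g i" b] unfolding r_eq by linarith
    qed
    have "(\<Inter>i\<in>{1..n}. mcball_of ?Y (f (g i)) (r i)) \<noteq> {}"
    proof (rule helly[unfolded Helly_def, rule_format], intro conjI ballI allI impI)
      fix I :: "nat set"
      assume I: "I \<subseteq> {1..n}" "card I = 2"
      then obtain i j where ij: "I = {i, j}" by (meson card_2_iff)
      then have i: "i \<in> {1..n}" "g i \<in> A" and j: "j \<in> {1..n}" "g j \<in> A" using I g by blast+
      have "mdist ?Y (f (g i)) (f (g j)) \<le> mdist ?X (g i) (g j)" using lip i j by blast
      also have "\<dots> \<le> mdist ?X (g i) b + mdist ?X b (g j)"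
        using i j A(3) b by (intro mdist_triangle) (auto simp: Zd_mspace)
      also have "\<dots> = r i + r j" by (simp add: r_def mdist_commute)
      finally have "real_of_int (int (graph_dist H (f (g i)) (f (g j)))) \<le>
          real_of_int (l1_dist d (g i) b + l1_dist d (g j) b)"
        using r i j by (simp add: H_simps)
      then have "int (graph_dist H (f (g i)) (f (g j))) \<le> \<lfloor>r i\<rfloor> + \<lfloor>r j\<rfloor>"
        unfolding of_int_le_iff using r i j by simp
      then have "mcball_of ?Y (f (g i)) (r i) \<inter> mcball_of ?Y (f (g j)) (r j) \<noteq> {}"
        using ball_inter_nonempty_iff[OF H fA[OF i(2)] fA[OF j(2)], of "r i" "r j"] r(2)[OF i(1)] r(2)[OF j(1)]
        by linarith
      then show "(\<Inter>i\<in>I. mcball_of ?Y (f (g i)) (r i)) \<noteq> {}" using ij by simp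
    qed (use r fA g in auto)
    then obtain y where y: "\<And>i. i \<in> {1..n} \<Longrightarrow> y \<in> mcball_of ?Y (f (g i)) (r i)" by blast
    have "mdist ?Y (f a) y \<le> mdist ?X a b \<and> y \<in> mspace ?Y" if "a \<in> A" for a
      using that y g by (auto simp: in_mcball_of r_def)
    then show ?thesis using 3(1) unfolding point_extends_def by blast
  qed
qed

section \<open>Finite sets with more than \<open>2d\<close> points\<close>

lemma exists_non_extremal:
  fixes \<phi> :: "'i \<Rightarrow> 'a \<Rightarrow> int"
  assumes "finite D" "finite A" "card D < card A"
  obtains z where "z \<in> A" "\<And>\<delta>. \<delta> \<in> D \<Longrightarrow> \<exists>a\<in>A. a \<noteq> z \<and> \<phi> \<delta> z \<le> \<phi> \<delta> a"
proof -
  have "A \<noteq> {}" using assms(3) by auto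
  then have "\<exists>a\<in>A. \<forall>z\<in>A. \<phi> \<delta> z \<le> \<phi> \<delta> a" for \<delta>
    using assms(2) ex_is_arg_min_if_finite[of A "\<lambda>a. - \<phi> \<delta> a"]
    by (auto simp: is_arg_min_linorder)
  \<comment> \<open>One maximiser is chosen per direction. These are fewer than
    \<open>card A\<close> points, so some \<open>z\<close> is not among them, and
    \<open>m \<delta>\<close> is then a second point reaching at least as far.\<close>
  then obtain m where m: "\<And>\<delta>. m \<delta> \<in> A" "\<And>\<delta> z. z \<in> A \<Longrightarrow> \<phi> \<delta> z \<le> \<phi> \<delta> (m \<delta>)" by metis
  have "card (m ` D) < card A" using card_image_le[OF assms(1), of m] assms(3) by simp
  then obtain z where "z \<in> A" "z \<notin> m ` D"
    using card_mono[of "m ` D" A] assms(1) by (meson finite_imageI not_less subsetI)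
  moreover have "\<exists>a\<in>A. a \<noteq> z \<and> \<phi> \<delta> z \<le> \<phi> \<delta> a" if "\<delta> \<in> D" for \<delta>
    using m(1)[of \<delta>] m(2)[OF \<open>z \<in> A\<close>, of \<delta>] \<open>z \<notin> m ` D\<close> that by (intro bexI[of _ "m \<delta>"]) auto
  ultimately show ?thesis using that by blast
qed

text \<open>The outer induction on \<open>card A\<close> quantifies over \<open>f\<close> and
  \<open>b\<close>, because it is applied to a modified map on a smaller set. The inner induction on
  the distance from \<open>b\<close> to \<open>z\<close> keeps \<open>A\<close>, \<open>f\<close>
  and \<open>z\<close> fixed.\<close>

lemma point_extends_finite:
  assumes H: "pair_bidirected_digraph H" "Digraph_Component.connected (with_proj H)"
    and helly: "Helly (2 * d) 2 H"
    and "finite A" "A \<subseteq> pverts (Zd_graph d)" "b \<in> pverts (Zd_graph d)"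
    and "one_Lipschitz (submetric (path_metric (Zd_graph d)) A) (path_metric H) f"
  shows "point_extends (path_metric (Zd_graph d)) (path_metric H) A f b"
  using assms(4-)
proof (induction "card A" arbitrary: A f b rule: less_induct)
  case outer: less
  let ?X = "path_metric (Zd_graph d)" and ?Y = "path_metric H"
  show ?case
  proof (cases "card A \<le> 2 * d")
    case True
    then show ?thesis using point_extends_small[OF H helly] outer.prems by blast
  next
    case False
    have AX: "A \<subseteq> mspace ?X" using outer.prems(2) by (simp add: Zd_mspace)
    have fA: "f \<in> A \<rightarrow> mspace ?Y"
      and lip: "\<And>a a'. a \<in> A \<Longrightarrow> a' \<in> A \<Longrightarrow> mdist ?Y (f a) (f a') \<le> mdist ?X a a'"
      using outer.prems(4) unfolding one_Lipschitz_submetric[OF AX] by auto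
    \<comment> \<open>The pair \<open>(i, s)\<close> encodes the direction of \<open>s\<close> times
      the generator number \<open>i\<close>; a point \<open>a\<close> reaches as far as
      \<open>s * a i\<close> in it.\<close>
    have "card ({..<d} \<times> {1, - 1 :: int}) < card A"
      using False by (simp add: card_cartesian_product)
    from exists_non_extremal[OF _ outer.prems(1) this, where \<phi> = "\<lambda>(i, s) a. s * a i"]
    obtain z where z: "z \<in> A" "\<And>\<delta>. \<delta> \<in> {..<d} \<times> {1, - 1 :: int} \<Longrightarrow>
        \<exists>a\<in>A. a \<noteq> z \<and> (case \<delta> of (i, s) \<Rightarrow> s * z i) \<le> (case \<delta> of (i, s) \<Rightarrow> s * a i)"
      by auto
    have zX: "z \<in> pverts (Zd_graph d)" using z(1) outer.prems(2) by blast
    show ?thesis using outer.prems(3)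
    proof (induction "nat (l1_dist d b z)" arbitrary: b rule: less_induct)
      case (less b)
      show ?case
      proof (cases "b = z")
        case True
        then show ?thesis using z(1) lip fA unfolding point_extends_def by blast
      next
        case False
        then obtain i s where i: "i < d" "s = 1 \<or> s = - 1" "0 < s * (z i - b i)"
          "l1_dist d b z = l1_dist d (b(i := b i + s)) z + 1"
          using Zd_step[OF less.prems zX] by metis
        define b' where "b' = b(i := b i + s)"
        have b': "b' \<in> pverts (Zd_graph d)"
          using less.prems i(1) by (auto simp: Zd_verts b'_def)
        have "nat (l1_dist d b' z) < nat (l1_dist d b z)"
          using i(4) l1_dist_nonneg[of d b' z] by (simp add: b'_def)
        from less.hyps[OF this b'] obtain y where y: "y \<in> mspace ?Y"
          "\<And>a. a \<in> A \<Longrightarrow> mdist ?Y (f a) y \<le> mdist ?X a b'"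
          unfolding point_extends_def by blast
        \<comment> \<open>The points of \<open>A\<close> strictly beyond \<open>b\<close> in
          direction \<open>(i, s)\<close>: for each of them \<open>b'\<close> lies on a geodesic to
          \<open>b\<close>.\<close>
        define U where "U = {a \<in> A. 0 < s * (a i - b i)}"
        have dist_b: "mdist ?X a b = mdist ?X a b' + mdist ?X b' b" if "0 < s * (a i - b i)"
          "a \<in> pverts (Zd_graph d)" for a
        proof -
          have "l1_dist d b' a = l1_dist d b a - 1" "l1_dist d b' b = 1"
            using l1_dist_upd[OF i(1), of b "b i + s"] i(2) that(1)
            by (auto simp: b'_def) (auto simp: l1_dist_def)
          then show ?thesis
            using that(2) b' less.prems by (simp add: Zd_mdist l1_dist_commute[of d a])
        qed
        \<comment> \<open>If \<open>b'\<close> is in \<open>A\<close>, it is in \<open>U\<close>, so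
          redefining \<open>f\<close> at \<open>b'\<close> leaves the values on \<open>A - U\<close>
          unchanged.\<close>
        have b'U: "b' \<notin> A - U" using i(2) by (auto simp: U_def b'_def)
        \<comment> \<open>By the choice of \<open>z\<close>, a second point lies in
          \<open>U\<close>. Trading \<open>U\<close> for \<open>b'\<close> therefore lowers the
          cardinality.\<close>
        obtain a where a: "a \<in> A" "a \<noteq> z" "s * z i \<le> s * a i" using z(2)[of "(i, s)"] i(1,2) by auto
        have "{z, a} \<subseteq> U" using a z(1) i(3) by (auto simp: U_def right_diff_distrib)
        moreover have finU: "finite U" "U \<subseteq> A" using outer.prems(1) by (auto simp: U_def)
        ultimately have "2 \<le> card U" using card_mono[of U "{z, a}"] a(2) by auto
        moreover have "card (A - U) = card A - card U" using finU by (simp add: card_Diff_subset)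
        moreover have "card U \<le> card A" using finU outer.prems(1) by (simp add: card_mono)
        ultimately have small: "card (insert b' (A - U)) < card A"
          using outer.prems(1) b'U by simp
        let ?f = "f(b' := y)"
        have f_eq: "?f a = f a" if "a \<in> A - U" for a using that b'U by auto
        have insX: "insert b' (A - U) \<subseteq> mspace ?X" using AX b' by (auto simp: Zd_mspace)
        have f': "one_Lipschitz (submetric ?X (insert b' (A - U))) ?Y ?f"
          unfolding one_Lipschitz_submetric[OF insX]
        proof (intro conjI ballI Pi_I)
          show "?f x \<in> mspace ?Y" if "x \<in> insert b' (A - U)" for x
            using that fA y(1) by auto
          fix u v
          assume "u \<in> insert b' (A - U)" "v \<in> insert b' (A - U)"
          then consider "u = b'" "v = b'" | "u = b'" "v \<in> A - U" | "u \<in> A - U" "v = b'"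
            | "u \<in> A - U" "v \<in> A - U" by blast
          then show "mdist ?Y (?f u) (?f v) \<le> mdist ?X u v"
          proof cases
            case 1
            then show ?thesis using y(1) by (simp add: mdist_self_le)
          next
            case 2
            then show ?thesis using y(2)[of v] f_eq by (simp add: mdist_commute)
          next
            case 3
            then show ?thesis using y f_eq by simp
          next
            case 4
            then show ?thesis using lip f_eq by simp
          qed
        qed
        have "point_extends ?X ?Y (insert b' (A - U)) ?f b"
          using outer.hyps[OF small] outer.prems(1) insX less.prems f' by (simp add: Zd_mspace)
        then obtain w where w: "w \<in> mspace ?Y" "mdist ?Y y w \<le> mdist ?X b' b"
          "\<And>a. a \<in> A - U \<Longrightarrow> mdist ?Y (f a) w \<le> mdist ?X a b"
          using f_eq unfolding point_extends_def by force
        \<comment> \<open>The points of \<open>U\<close> were dropped; their bounds are recovered by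
          passing through the value \<open>y\<close> at \<open>b'\<close>.\<close>
        have "mdist ?Y (f a) w \<le> mdist ?X a b" if a: "a \<in> A" for a
        proof (cases "a \<in> U")
          case True
          have "mdist ?Y (f a) w \<le> mdist ?Y (f a) y + mdist ?Y y w"
            using a fA y(1) w(1) by (intro mdist_triangle) auto
          also have "\<dots> \<le> mdist ?X a b' + mdist ?X b' b"
            using y(2)[OF a] w(2) by (rule add_mono)
          also have "\<dots> = mdist ?X a b"
            using dist_b True a outer.prems(2) by (auto simp: U_def)
          finally show ?thesis .
        qed (use a w(3) in blast)
        then show ?thesis using w(1) unfolding point_extends_def by blast
      qed
    qed
  qed
qed

section \<open>The two implications\<close>

lemma Helly_imp_Kirszbraun:
  assumes H: "pair_bidirected_digraph H" "Digraph_Component.connected (with_proj H)"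
    and helly: "Helly (2 * d) 2 H"
  shows "Kirszbraun (path_metric (Zd_graph d)) (path_metric H)"
proof (rule Kirszbraun_if_point_extends)
  let ?X = "path_metric (Zd_graph d)" and ?Y = "path_metric H"
  fix A f b
  assume A: "A \<subseteq> mspace ?X" and b: "b \<in> mspace ?X" and f: "one_Lipschitz (submetric ?X A) ?Y f"
  \<comment> \<open>\<open>F\<close> depends on \<open>b\<close>, which is harmless since only one
    point is added at a time.\<close>
  obtain F where F: "finite F" "F \<subseteq> A"
    "\<And>a. a \<in> A \<Longrightarrow> \<exists>a'\<in>F. l1_dist d a b = l1_dist d a a' + l1_dist d a' b"
    using Zd_finite_geodesic_subset[of A d b] by blast
  have FX: "F \<subseteq> mspace ?X" using F(2) A by blast
  show "point_extends ?X ?Y A f b"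
  proof (rule point_extends_geodesic)
    show "f \<in> A \<rightarrow> mspace ?Y" using f unfolding one_Lipschitz_submetric[OF A] by blast
    have "one_Lipschitz (submetric ?X F) ?Y f"
      using f F(2) unfolding one_Lipschitz_submetric[OF A] one_Lipschitz_submetric[OF FX] by blast
    then show "point_extends ?X ?Y F f b"
      using F(1) FX b point_extends_finite[OF H helly] by (simp add: Zd_mspace)
    fix a
    assume a: "a \<in> A"
    obtain a' where a': "a' \<in> F" "l1_dist d a b = l1_dist d a a' + l1_dist d a' b"
      using F(3)[OF a] by blast
    have V: "a \<in> pverts (Zd_graph d)" "a' \<in> pverts (Zd_graph d)" "b \<in> pverts (Zd_graph d)"
      using a a'(1) A FX b by (auto simp: Zd_mspace)
    have "mdist ?Y (f a) (f a') \<le> mdist ?X a a'"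
      using f a a'(1) F(2) unfolding one_Lipschitz_submetric[OF A] by blast
    then show "\<exists>a'\<in>F. mdist ?X a b = mdist ?X a a' + mdist ?X a' b
        \<and> mdist ?Y (f a) (f a') \<le> mdist ?X a a'"
      using a' V by (auto simp: Zd_mdist intro!: bexI[of _ a'])
  qed (rule F)
qed

text \<open>Points on different half-axes have a distance equal to the sum of their distances to the
  origin. This is exactly the bound on the distance of two centres that intersecting balls give, so
  sending the points to the centres is 1-Lipschitz. The value of an extension at the origin lies in
  all balls.\<close>

lemma Kirszbraun_imp_Helly:
  assumes H: "pair_bidirected_digraph H" "Digraph_Component.connected (with_proj H)"
    and d: "1 \<le> d" and K: "Kirszbraun (path_metric (Zd_graph d)) (path_metric H)"
  shows "Helly (2 * d) 2 H"
  unfolding Helly_def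
proof (intro allI impI, elim conjE)
  let ?X = "path_metric (Zd_graph d)" and ?Y = "path_metric H"
  note H_simps = path_metric_simps[OF H]
  fix c :: "nat \<Rightarrow> 'a" and r :: "nat \<Rightarrow> real"
  assume cr: "\<forall>i\<in>{1..2 * d}. c i \<in> pverts H \<and> 1 \<le> r i"
    and two: "\<forall>I\<subseteq>{1..2 * d}. card I = 2 \<longrightarrow> (\<Inter>i\<in>I. mcball_of ?Y (c i) (r i)) \<noteq> {}"
  \<comment> \<open>Indices up to \<open>d\<close> stand for the positive half-axes and the others
    for the negative ones; \<open>k i\<close> is the axis, counted from 0. Radii are rounded down to
    obtain lattice points.\<close>
  define k where "k i = (if i \<le> d then i - 1 else i - d - 1)" for i
  define n where "n i = \<lfloor>r i\<rfloor>" for i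
  define v where "v i = (if i \<le> d then n i else - n i)" for i
  define p where "p i = (\<lambda>l. if l = k i then v i else 0)" for i
  have k: "k i < d" if "i \<in> {1..2 * d}" for i using that by (auto simp: k_def)
  have fl: "1 \<le> n i" "\<bar>v i\<bar> = n i" if "i \<in> {1..2 * d}" for i
  proof -
    show "1 \<le> n i" using that cr by (simp add: n_def le_floor_iff)
    then show "\<bar>v i\<bar> = n i" by (simp add: v_def)
  qed
  have pX: "p i \<in> pverts (Zd_graph d)" if "i \<in> {1..2 * d}" for i
    using k[OF that] by (auto simp: Zd_verts p_def)
  have p0: "l1_dist d (p i) (\<lambda>_. 0) = n i" if "i \<in> {1..2 * d}" for i
  proof -
    have "l1_dist d (p i) (\<lambda>_. 0) = (\<Sum>l<d. if l = k i then \<bar>v i\<bar> else 0)"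
      unfolding l1_dist_def p_def by (intro sum.cong) auto
    then show ?thesis using k[OF that] fl[OF that] by simp
  qed
  have pp: "l1_dist d (p i) (p j) = n i + n j"
    if ij: "i \<in> {1..2 * d}" "j \<in> {1..2 * d}" "i \<noteq> j" for i j
  proof -
    \<comment> \<open>Two distinct indices on the same axis have opposite signs; otherwise the
      supports are disjoint.\<close>
    have "\<bar>p i l - p j l\<bar> = \<bar>p i l - 0\<bar> + \<bar>p j l - 0\<bar>" for l
    proof (cases "l = k i \<and> l = k j")
      case True
      then have "(i \<le> d) \<noteq> (j \<le> d)" using ij by (auto simp: k_def split: if_splits)
      then show ?thesis using True fl(1)[OF ij(1)] fl(1)[OF ij(2)] by (auto simp: p_def v_def)
    qed (auto simp: p_def)
    then have "l1_dist d (p i) (p j) = l1_dist d (p i) (\<lambda>_. 0) + l1_dist d (p j) (\<lambda>_. 0)"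
      unfolding l1_dist_def by (simp add: sum.distrib)
    then show ?thesis using p0 ij by simp
  qed
  have inj: "inj_on p {1..2 * d}"
  proof (rule inj_onI, rule ccontr)
    fix i j
    assume ij: "i \<in> {1..2 * d}" "j \<in> {1..2 * d}" "p i = p j" "i \<noteq> j"
    then have "l1_dist d (p i) (p j) = 0" by (simp add: l1_dist_def)
    then show False using pp[OF ij(1,2,4)] fl(1)[OF ij(1)] fl(1)[OF ij(2)] by simp
  qed
  \<comment> \<open>Centres may coincide, but the points \<open>p i\<close> are distinct because the
    radii are at least 1, so \<open>f\<close> is well defined.\<close>
  define f where "f = c \<circ> the_inv_into {1..2 * d} p"
  have fp: "f (p i) = c i" if "i \<in> {1..2 * d}" for i
    using that inj by (simp add: f_def the_inv_into_f_f)
  have AX: "p ` {1..2 * d} \<subseteq> mspace ?X" using pX by (auto simp: Zd_mspace)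
  have "one_Lipschitz (submetric ?X (p ` {1..2 * d})) ?Y f"
    unfolding one_Lipschitz_submetric[OF AX]
  proof (intro conjI ballI)
    show "f \<in> p ` {1..2 * d} \<rightarrow> mspace ?Y" using fp cr by (auto simp: H_simps)
    fix x y
    assume "x \<in> p ` {1..2 * d}" "y \<in> p ` {1..2 * d}"
    then obtain i j where i: "i \<in> {1..2 * d}" "x = p i" and j: "j \<in> {1..2 * d}" "y = p j" by blast
    have ci: "c i \<in> pverts H" and cj: "c j \<in> pverts H" using cr i j by blast+
    show "mdist ?Y (f x) (f y) \<le> mdist ?X x y"
    proof (cases "i = j")
      case True
      then show ?thesis using i j fp ci by (simp add: H_simps(1) mdist_self_le)
    next
      case False
      then have "mcball_of ?Y (c i) (r i) \<inter> mcball_of ?Y (c j) (r j) \<noteq> {}"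
        using two[rule_format, of "{i, j}"] i(1) j(1) by simp
      then have "int (graph_dist H (c i) (c j)) \<le> l1_dist d (p i) (p j)"
        using ball_inter_nonempty_iff[OF H ci cj] pp[OF i(1) j(1) False] by (simp add: n_def)
      then have "real (graph_dist H (c i) (c j)) \<le> real_of_int (l1_dist d (p i) (p j))"
        by linarith
      then show ?thesis using i j fp pX by (simp add: H_simps(2) Zd_mdist)
    qed
  qed
  then have "\<exists>g. one_Lipschitz ?X ?Y g \<and> (\<forall>a\<in>p ` {1..2 * d}. g a = f a)"
    using K[unfolded Kirszbraun_def, rule_format, of "p ` {1..2 * d}" f] AX by simp
  then obtain g where g: "one_Lipschitz ?X ?Y g" "\<And>a. a \<in> p ` {1..2 * d} \<Longrightarrow> g a = f a"
    by blast
  have z: "(\<lambda>_. 0) \<in> pverts (Zd_graph d)" by (simp add: Zd_verts)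
  have "g (\<lambda>_. 0) \<in> mcball_of ?Y (c i) (r i)" if i: "i \<in> {1..2 * d}" for i
  proof -
    have "mdist ?Y (g (p i)) (g (\<lambda>_. 0)) \<le> mdist ?X (p i) (\<lambda>_. 0)"
      using g(1) pX[OF i] z unfolding one_Lipschitz_def Zd_mspace by blast
    also have "\<dots> \<le> r i" using pX[OF i] z p0[OF i] by (simp add: Zd_mdist n_def)
    finally have "mdist ?Y (c i) (g (\<lambda>_. 0)) \<le> r i" using g(2) fp i by simp
    moreover have "g (\<lambda>_. 0) \<in> pverts H"
      using g(1) z unfolding one_Lipschitz_def Zd_mspace H_simps(1) by blast
    ultimately show ?thesis using cr i by (simp add: in_mcball_of H_simps(1))
  qed
  then show "(\<Inter>i\<in>{1..2 * d}. mcball_of ?Y (c i) (r i)) \<noteq> {}" by blast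
qed

theorem theorem1p1:
  fixes d :: nat and H :: "'a pair_pre_digraph"
  assumes "d \<ge> 1"
    and "pair_bidirected_digraph H"
    and "Digraph_Component.connected (with_proj H)"
  shows "Kirszbraun (path_metric (Zd_graph d)) (path_metric H) \<longleftrightarrow> Helly (2 * d) 2 H"
  using Kirszbraun_imp_Helly Helly_imp_Kirszbraun assms by blast

end
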